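(* For any two finite abstract simplicial complexes $G,H$, the Euler characteristic of the join satisfies $$\chi(G+H)=\chi(G)+\chi(H)-\chi(G)\chi(H).$$
   Context: A finite abstract simplicial complex is a finite set of non-empty finite sets (simplices) closed under taking non-empty subsets; a simplex $x$ has dimension $|x|-1$. For complexes $G,H$ on disjoint vertex sets, the join $G+H$ has as simplices the simplices of $G$, the simplices of $H$, and all unions $x\cup y$ with $x\in G$, $y\in H$. The Euler characteristic is $\chi(G)=\sum_{x\in G}(-1)^{\dim(x)}$. *)

theory Defs
  imports Main
begin

definition finite_abstract_complex :: "'a set set \<Rightarrow> bool" where
  "finite_abstract_complex G \<longleftrightarrow>
     finite G \<and>
     (\<forall>x\<in>G. finite x \<and> x \<noteq> {}) \<and>
     (\<forall>x\<in>G. \<forall>y. y \<subseteq> x \<longrightarrow> y \<noteq> {} \<longrightarrow> y \<in> G)"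

definition complex_vertices :: "'a set set \<Rightarrow> 'a set" where
  "complex_vertices G = \<Union>G"

text \<open>Subtraction on the naturals never truncates here, since simplices are finite and non-empty.\<close>

definition simplex_dim :: "'a set \<Rightarrow> nat" where
  "simplex_dim x = card x - 1"

definition euler_char :: "'a set set \<Rightarrow> int" where
  "euler_char G = (\<Sum>x\<in>G. (-1) ^ simplex_dim x)"

text \<open>The join is meaningful for complexes whose vertex sets are disjoint. The empty set is
  not a simplex, so the simplices of each of the two complexes have to be included separately.\<close>

definition complex_join :: "'a set set \<Rightarrow> 'a set set \<Rightarrow> 'a set set" where
  "complex_join G H = G \<union> H \<union> {x \<union> y | x y. x \<in> G \<and> y \<in> H}"

end

theory Submission
  imports Defs
begin

text \<open>Give each simplex the weight (-1)^dim, so that the Euler characteristic is total weight.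
  The join consists of three disjoint families: \<open>G\<close>, \<open>H\<close> and the mixed
  unions. For a mixed union cardinalities add, hence dim(x \<union> y) = dim x + dim y + 1, and the
  extra 1 makes its weight minus the product of the two weights; this is
  \<open>neg_one_power_dim_union\<close>. Disjointness of the vertex sets makes each mixed simplex
  come from exactly one pair, so the mixed weights sum to minus the product of the two Euler
  characteristics.\<close>

lemma neg_one_power_dim_union:
  assumes "finite x" "finite y" "x \<noteq> {}" "y \<noteq> {}" "x \<inter> y = {}"
  shows "(-1 :: int) ^ simplex_dim (x \<union> y) = - ((-1) ^ simplex_dim x * (-1) ^ simplex_dim y)"
proof -
  have "card x > 0" "card y > 0"
    using assms by (simp_all add: card_gt_0_iff)
  moreover have "card (x \<union> y) = card x + card y"
    using assms by (simp add: card_Un_disjoint)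
  ultimately have "simplex_dim (x \<union> y) = Suc (simplex_dim x + simplex_dim y)"
    by (simp add: simplex_dim_def)
  then show ?thesis
    by (simp add: power_add)
qed

theorem corollary3:
  fixes G H :: "'a set set"
  assumes "finite_abstract_complex G"
    and "finite_abstract_complex H"
    and "complex_vertices G \<inter> complex_vertices H = {}"
  shows "euler_char (complex_join G H) =
           euler_char G + euler_char H - euler_char G * euler_char H"
proof -
  let ?f = "\<lambda>x :: 'a set. (-1 :: int) ^ simplex_dim x"
  let ?u = "\<lambda>(x :: 'a set, y). x \<union> y"
  let ?J = "?u ` (G \<times> H)"
  have fin: "finite G" "finite H"
    using assms(1,2) by (auto simp: finite_abstract_complex_def)
  have G: "finite x \<and> x \<noteq> {}" if "x \<in> G" for x
    using assms(1) that by (auto simp: finite_abstract_complex_def)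
  have H: "finite y \<and> y \<noteq> {}" if "y \<in> H" for y
    using assms(2) that by (auto simp: finite_abstract_complex_def)
  have sub: "x \<subseteq> \<Union>G" if "x \<in> G" for x using that by blast
  have sub': "y \<subseteq> \<Union>H" if "y \<in> H" for y using that by blast
  have disj: "\<Union>G \<inter> \<Union>H = {}"
    using assms(3) by (simp add: complex_vertices_def)
  \<comment> \<open>Cutting a mixed simplex with the two vertex sets recovers its two factors; this
    supplies the left inverse used for \<open>inj\<close>.\<close>
  have parts: "(x \<union> y) \<inter> \<Union>G = x" "(x \<union> y) \<inter> \<Union>H = y" "x \<inter> y = {}"
    if "x \<in> G" "y \<in> H" for x y
    using sub[OF that(1)] sub'[OF that(2)] disj by blast+
  have inj: "inj_on ?u (G \<times> H)"
    by (rule inj_on_inverseI[where g = "\<lambda>z. (z \<inter> \<Union>G, z \<inter> \<Union>H)"]) 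
      (clarsimp simp only: mem_Times_iff fst_conv snd_conv case_prod_conv parts simp_thms)
  \<comment> \<open>A common simplex would lie in both vertex sets and so be empty.\<close>
  have GH: "G \<inter> H = {}"
    using G sub sub' disj by blast
  have GJ: "(G \<union> H) \<inter> ?J = {}"
  proof -
    \<comment> \<open>If the union were in \<open>G\<close>, then \<open>y\<close> would lie in both
      vertex sets and be empty; if it were in \<open>H\<close>, the same would hold for
      \<open>x\<close>.\<close>
    have "x \<union> y \<notin> G \<union> H" if "x \<in> G" "y \<in> H" for x y
      using sub[of "x \<union> y"] sub'[of "x \<union> y"] sub[OF that(1)] sub'[OF that(2)]
        G[OF that(1)] H[OF that(2)] disj by blast
    then show ?thesis by auto
  qed
  have "sum ?f ?J = (\<Sum>(x, y)\<in>G \<times> H. ?f (x \<union> y))"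
    unfolding sum.reindex[OF inj] by (simp add: comp_def case_prod_unfold)
  also have "\<dots> = (\<Sum>(x, y)\<in>G \<times> H. - (?f x * ?f y))"
    by (rule sum.cong[OF refl]) (clarsimp simp: G H parts(3) neg_one_power_dim_union)
  also have "\<dots> = - (sum ?f G * sum ?f H)"
    by (simp add: sum_product sum.cartesian_product sum_negf case_prod_unfold)
  finally have J: "sum ?f ?J = - (sum ?f G * sum ?f H)" .
  have "complex_join G H = (G \<union> H) \<union> ?J"
    by (auto simp: complex_join_def)
  then have "euler_char (complex_join G H) = sum ?f G + sum ?f H + sum ?f ?J"
    unfolding euler_char_def using fin GH GJ by (simp add: sum.union_disjoint)
  then show ?thesis
    by (simp add: J euler_char_def)
qed

end
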